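(* Let $k>0$ and let $u\in C_{+,\log}$ be (log, $x^k$)-convex. Then $$\ell_u(n)\,\ell_u(m)\le \ell_u(0)\,2^{k(n+m)}\,\ell_u(n+m)\qquad\text{for all integers } n,m\ge 0.$$
   Context: $C_{+,\log}$ denotes the set of all positive continuous functions $u:[0,\infty)\to(0,\infty)$ with $\lim_{r\to\infty}\frac{\log u(r)}{\log r}=\infty$. For $u\in C_{+,\log}$ the Legendre transform is $\ell_u(t)=\inf_{r>0}\frac{u(r)}{r^t}$, $t\in[0,\infty)$. For a real number $k>0$, a positive continuous function $u$ on $[0,\infty)$ is (log, $x^k$)-convex if $x\mapsto\log u(x^k)$ is convex on $[0,\infty)$. *)

theory Defs
  imports "HOL-Analysis.Analysis"
begin

text \<open>Functions on $[0,\infty)$ are modelled as total functions on the reals; all conditions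
  below only depend on their values on \<open>{0..}\<close>.\<close>

definition C_plus_log :: "(real \<Rightarrow> real) set" where
  "C_plus_log = {u. continuous_on {0..} u \<and> (\<forall>r\<ge>0. u r > 0) \<and>
     filterlim (\<lambda>r. ln (u r) / ln r) at_top at_top}"

definition legendre_transform :: "(real \<Rightarrow> real) \<Rightarrow> real \<Rightarrow> real" where
  "legendre_transform u t = (INF r\<in>{0<..}. u r / r powr t)"

text \<open>For \<open>k > 0\<close>, \<open>x powr k\<close> is the usual power on all of \<open>{0..}\<close>, since \<open>0 powr k = 0\<close>.\<close>

definition log_power_convex :: "real \<Rightarrow> (real \<Rightarrow> real) \<Rightarrow> bool" where
  "log_power_convex k u \<longleftrightarrow> k > 0 \<and> continuous_on {0..} u \<and> (\<forall>r\<ge>0. u r > 0) \<and>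
     convex_on {0..} (\<lambda>x. ln (u (x powr k)))"

end

theory Submission
  imports Defs
begin

text \<open>
  Put \<open>f x = ln (u (x powr k))\<close>, which is convex on \<open>[0, \<infinity>)\<close>. For \<open>s, r > 0\<close> write
  \<open>s = x powr k\<close> and \<open>r = y powr k\<close>, and let \<open>p = ((x + y) / 2) powr k\<close> be the power of the
  midpoint. Midpoint convexity \<open>2 f ((x + y) / 2) \<le> f x + f y\<close> says \<open>u p * u p \<le> u s * u r\<close>, and
  \<open>(x + y) / 2 \<ge> y / 2\<close> says \<open>p \<ge> r / 2 powr k\<close>. Testing both infima on the left-hand side at the
  same point \<open>p\<close> therefore gives
  \<open>\<ell>(n) \<ell>(m) \<le> u p * u p / p powr (n + m) \<le> u s * 2 powr (k (n + m)) * u r / r powr (n + m)\<close>.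
  The point \<open>s\<close> occurs only in the factor \<open>u s\<close>, and \<open>r\<close> only in the other one, so the infimum over
  \<open>s\<close> produces \<open>\<ell>(0)\<close> and the infimum over \<open>r\<close> produces \<open>\<ell>(n + m)\<close>.
\<close>

lemma legendre_transform_le:
  assumes "\<And>r. r > 0 \<Longrightarrow> u r > 0" and "r > 0"
  shows "legendre_transform u t \<le> u r / r powr t"
  unfolding legendre_transform_def
proof (rule cINF_lower)
  show "bdd_below ((\<lambda>r. u r / r powr t) ` {0<..})"
    by (intro bdd_belowI[where m = 0]) (auto simp: assms(1)[THEN less_imp_le])
qed (use assms(2) in auto)

lemma le_legendre_transform:
  assumes "\<And>r. r > 0 \<Longrightarrow> c \<le> u r / r powr t"
  shows "c \<le> legendre_transform u t"
  unfolding legendre_transform_def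
  by (rule cINF_greatest) (use assms in auto)

lemma legendre_transform_nonneg:
  assumes "\<And>r. r > 0 \<Longrightarrow> u r > 0"
  shows "legendre_transform u t \<ge> 0"
  by (intro le_legendre_transform) (simp add: assms[THEN less_imp_le])

text \<open>Two infima may be taken independently of each other in a product. The positive constant \<open>c\<close>
  is carried along so that the factor \<open>2 powr (k * (n + m))\<close> can be split off.\<close>

lemma le_mult_legendre_transform:
  assumes pos: "\<And>r. r > 0 \<Longrightarrow> u r > 0" and c: "c > 0"
    and le: "\<And>s r. s > 0 \<Longrightarrow> r > 0 \<Longrightarrow> L \<le> (u s / s powr a) * c * (u r / r powr b)"
  shows "L \<le> legendre_transform u a * c * legendre_transform u b"
proof -
  have inf_a: "L \<le> legendre_transform u a * (c * (u r / r powr b))" if "r > 0" for r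
  proof -
    have d: "c * (u r / r powr b) > 0" using pos[OF that] c that by simp
    have "L / (c * (u r / r powr b)) \<le> legendre_transform u a"
    proof (rule le_legendre_transform)
      fix s :: real assume "s > 0"
      from le[OF this that] show "L / (c * (u r / r powr b)) \<le> u s / s powr a"
        unfolding pos_divide_le_eq[OF d] by (simp only: mult.assoc)
    qed
    then show ?thesis unfolding pos_divide_le_eq[OF d] .
  qed
  show ?thesis
  proof (cases "legendre_transform u a = 0")
    case True
    then show ?thesis using inf_a[of 1] by simp
  next
    case False
    with legendre_transform_nonneg[of u a] pos c
    have d: "legendre_transform u a * c > 0" by (simp add: less_le)
    have "L / (legendre_transform u a * c) \<le> legendre_transform u b"
    proof (rule le_legendre_transform)
      fix r :: real assume "r > 0"
      from inf_a[OF this] show "L / (legendre_transform u a * c) \<le> u r / r powr b"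
        unfolding pos_divide_le_eq[OF d] by (simp only: ac_simps)
    qed
    then show ?thesis unfolding pos_divide_le_eq[OF d] by (simp only: ac_simps)
  qed
qed

lemma log_power_convex_midpoint:
  assumes "log_power_convex k u" and "x \<ge> 0" and "y \<ge> 0"
  shows "u (((x + y) / 2) powr k) ^ 2 \<le> u (x powr k) * u (y powr k)"
proof -
  have pos: "u r > 0" if "r \<ge> 0" for r
    using assms(1) that by (simp add: log_power_convex_def)
  have conv: "convex_on {0..} (\<lambda>x. ln (u (x powr k)))"
    using assms(1) by (simp add: log_power_convex_def)
  have "2 * ln (u (((x + y) / 2) powr k)) \<le> ln (u (x powr k)) + ln (u (y powr k))"
    using convex_onD[OF conv, of "1/2" x y] assms(2,3)
    by (simp add: add_divide_distrib)
  then have "ln (u (((x + y) / 2) powr k) ^ 2) \<le> ln (u (x powr k) * u (y powr k))"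
    using pos[of "x powr k"] pos[of "y powr k"] pos[of "((x + y) / 2) powr k"]
    by (simp add: ln_mult ln_realpow)
  then show ?thesis
    using pos[of "x powr k"] pos[of "y powr k"] pos[of "((x + y) / 2) powr k"]
    by simp
qed

text \<open>The pointwise form of the bound, with arbitrary points \<open>s\<close> and \<open>r\<close> in place of the infima on
  the right. Both transforms on the left are tested at the \<open>k\<close>-th power of the midpoint of
  \<open>s powr (1 / k)\<close> and \<open>r powr (1 / k)\<close>.\<close>

lemma legendre_transform_mult_le:
  assumes conv: "log_power_convex k u" and "s > 0" and "r > 0" and ab: "a + b \<ge> 0"
  shows "legendre_transform u a * legendre_transform u b
    \<le> u s * 2 powr (k * (a + b)) * (u r / r powr (a + b))"
proof -
  have k: "k > 0"
    using conv by (simp add: log_power_convex_def)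
  have pos: "u q > 0" if "q \<ge> 0" for q
    using conv that by (simp add: log_power_convex_def)
  define x y where "x = s powr (1 / k)" and "y = r powr (1 / k)"
  have xy: "x > 0" "y > 0" "x powr k = s" "y powr k = r"
    using \<open>s > 0\<close> \<open>r > 0\<close> k by (simp_all add: x_def y_def powr_powr)
  define p where "p = ((x + y) / 2) powr k"
  have p: "p > 0" using xy by (simp add: p_def)
  \<comment> \<open>Replacing the midpoint by the smaller \<open>y / 2\<close> is what costs the factor \<open>2 powr (k * (a + b))\<close>.\<close>
  have "(r / 2 powr k) powr (a + b) \<le> p powr (a + b)"
  proof (rule powr_mono2)
    have "(y / 2) powr k \<le> p"
      unfolding p_def using xy k by (intro powr_mono2) auto
    then show "r / 2 powr k \<le> p"
      using xy by (simp add: powr_divide)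
  qed (use ab \<open>r > 0\<close> in auto)
  then have denom: "r powr (a + b) / 2 powr (k * (a + b)) \<le> p powr (a + b)"
    using \<open>r > 0\<close> by (simp add: powr_divide powr_powr)
  have "legendre_transform u a * legendre_transform u b \<le> (u p / p powr a) * (u p / p powr b)"
    using p
    by (intro mult_mono legendre_transform_le legendre_transform_nonneg)
      (simp_all add: pos pos[THEN less_imp_le])
  also have "\<dots> = u p ^ 2 / p powr (a + b)"
    by (simp add: powr_add power2_eq_square)
  also have "\<dots> \<le> (u s * u r) / (r powr (a + b) / 2 powr (k * (a + b)))"
  proof (rule frac_le)
    show "u p ^ 2 \<le> u s * u r"
      using log_power_convex_midpoint[OF conv, of x y] xy by (simp add: p_def)
    show "0 \<le> u s * u r"
      using pos[of s] pos[of r] \<open>s > 0\<close> \<open>r > 0\<close> by simp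
    show "0 < r powr (a + b) / 2 powr (k * (a + b))"
      using \<open>r > 0\<close> by simp
  qed (fact denom)
  finally show ?thesis by (simp add: ac_simps)
qed

theorem theorem3p10:
  fixes k :: real and u :: "real \<Rightarrow> real" and n m :: nat
  assumes "k > 0"
    and "u \<in> C_plus_log"
    and "log_power_convex k u"
  shows "legendre_transform u (real n) * legendre_transform u (real m)
    \<le> legendre_transform u 0 * 2 powr (k * real (n + m)) * legendre_transform u (real (n + m))"
proof (rule le_mult_legendre_transform)
  fix s r :: real
  assume "s > 0" "r > 0"
  with legendre_transform_mult_le[OF assms(3) this, of "real n" "real m"]
  show "legendre_transform u (real n) * legendre_transform u (real m)
    \<le> (u s / s powr 0) * 2 powr (k * real (n + m)) * (u r / r powr real (n + m))"
    by simp
qed (use assms(3) in \<open>auto simp: log_power_convex_def\<close>)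

end
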